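(* Let $(X,\|\cdot\|)$ be a (real or complex) infinite-dimensional separable Banach space and let $A$ be a chaotic linear operator in $X$ satisfying the following: $A$ is densely defined, each power $A^n$ ($n\in\mathbb N$) is a closed operator, and there exist a set $Y\subseteq C^\infty(A):=\bigcap_{n=1}^\infty D(A^n)$ dense in $X$ and a mapping $B:Y\to Y$ such that (1) for every $f\in Y$: $ABf=f$; and (2) for every $f\in Y$: $A^nf\to 0$ and $B^nf\to 0$ as $n\to\infty$. If there exists an inverse $A^{-1}$ which is a bounded linear operator on $X$ (i.e., defined on all of $X$), then $A^{-1}$ is chaotic.
   Context: Operators may be unbounded; $D(\cdot)$ denotes the domain of an operator. The mapping $B:Y\to Y$ is not assumed linear or continuous, and $Y$ is only a set. A linear operator $T$ in a Banach space $X$ is called hypercyclic if there is a nonzero vector $f\in\bigcap_{n=0}^\infty D(T^n)$ (with $T^0:=I$) whose orbit $\{T^nf\}_{n\ge 0}$ is dense in $X$. A vector $f$ is a periodic point of $T$ if for some $N\in\mathbb N=\{1,2,\dots\}$ one has $f\in D(T^N)$ and $T^Nf=f$. The operator $T$ is called chaotic if it is hypercyclic and its set of periodic points is dense in $X$. *)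

theory Defs
  imports "HOL-Analysis.Analysis"
begin

text \<open>
  Real and complex Banach spaces are treated together.  Up to isometric isomorphism the only
  (commutative) normed field extensions of the reals with multiplicative norm, i.e. the only
  possible instances of \<open>real_normed_field\<close>, are the reals and the complex numbers.  A Banach space
  over such a field is a type of class \<open>banach\<close> (norm, completeness, underlying real structure)
  with a compatible scalar multiplication by the field.
\<close>

locale banach_space_over = vector_space smul
  for smul :: "'k::real_normed_field \<Rightarrow> 'x::banach \<Rightarrow> 'x" +
  assumes scale_of_real: "smul (of_real r) x = r *\<^sub>R x"
    and norm_scale: "norm (smul c x) = norm c * norm x"

lemma banach_space_over_real: "banach_space_over (scaleR :: real \<Rightarrow> 'x::banach \<Rightarrow> 'x)"
  by unfold_locales (simp_all add: algebra_simps)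

lemma banach_space_over_complex: "banach_space_over (\<lambda>c x :: complex. c * x)"
  by unfold_locales (simp_all add: algebra_simps norm_mult scaleR_conv_of_real)

definition infinite_dimensional :: "('k::field \<Rightarrow> 'x::ab_group_add \<Rightarrow> 'x) \<Rightarrow> bool" where
  "infinite_dimensional smul \<longleftrightarrow> \<not> (\<exists>S. finite S \<and> module.span smul S = UNIV)"

text \<open>
  A possibly unbounded operator in \<open>X\<close> is a partial map \<open>T :: 'x \<rightharpoonup> 'x\<close>; its domain is \<open>dom T\<close>,
  its graph is \<open>Map.graph T\<close>, and \<open>the (T x)\<close> is its value at \<open>x \<in> dom T\<close>.
\<close>

definition linear_operator ::
    "('k::field \<Rightarrow> 'x::ab_group_add \<Rightarrow> 'x) \<Rightarrow> ('x \<rightharpoonup> 'x) \<Rightarrow> bool" where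
  "linear_operator smul T \<longleftrightarrow>
     module.subspace smul (dom T) \<and>
     (\<forall>x\<in>dom T. \<forall>y\<in>dom T. the (T (x + y)) = the (T x) + the (T y)) \<and>
     (\<forall>c. \<forall>x\<in>dom T. the (T (smul c x)) = smul c (the (T x)))"

text \<open>Natural domain: \<open>x \<in> D(T\<^bsup>n+1\<^esup>)\<close> iff \<open>x \<in> D(T\<^bsup>n\<^esup>)\<close> and \<open>T\<^bsup>n\<^esup> x \<in> D(T)\<close>.\<close>

primrec op_pow :: "('x \<rightharpoonup> 'x) \<Rightarrow> nat \<Rightarrow> ('x \<rightharpoonup> 'x)" where
  "op_pow T 0 = Some"
| "op_pow T (Suc n) = T \<circ>\<^sub>m op_pow T n"

definition densely_defined :: "('x::topological_space \<rightharpoonup> 'x) \<Rightarrow> bool" where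
  "densely_defined T \<longleftrightarrow> closure (dom T) = UNIV"

definition closed_operator :: "('x::topological_space \<rightharpoonup> 'x) \<Rightarrow> bool" where
  "closed_operator T \<longleftrightarrow> closed (Map.graph T)"

definition C_infinity :: "('x \<rightharpoonup> 'x) \<Rightarrow> 'x set" where
  "C_infinity T = (\<Inter>n\<in>{1..}. dom (op_pow T n))"

definition hypercyclic ::
    "('k::real_normed_field \<Rightarrow> 'x::banach \<Rightarrow> 'x) \<Rightarrow> ('x \<rightharpoonup> 'x) \<Rightarrow> bool" where
  "hypercyclic smul T \<longleftrightarrow>
     linear_operator smul T \<and>
     (\<exists>f. f \<noteq> 0 \<and> f \<in> (\<Inter>n. dom (op_pow T n)) \<and>
          closure (range (\<lambda>n. the (op_pow T n f))) = UNIV)"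

definition periodic_point :: "('x \<rightharpoonup> 'x) \<Rightarrow> 'x \<Rightarrow> bool" where
  "periodic_point T f \<longleftrightarrow> (\<exists>N\<ge>1. op_pow T N f = Some f)"

definition chaotic ::
    "('k::real_normed_field \<Rightarrow> 'x::banach \<Rightarrow> 'x) \<Rightarrow> ('x \<rightharpoonup> 'x) \<Rightarrow> bool" where
  "chaotic smul T \<longleftrightarrow>
     hypercyclic smul T \<and> closure {f. periodic_point T f} = UNIV"

text \<open>\<open>S = T\<^sup>-\<^sup>1\<close>: the graph of \<open>S\<close> is the transposed graph of \<open>T\<close>, so that \<open>T\<close> is injective and
  \<open>dom S\<close> is the range of \<open>T\<close>.\<close>

definition is_inverse_operator :: "('x \<rightharpoonup> 'x) \<Rightarrow> ('x \<rightharpoonup> 'x) \<Rightarrow> bool" where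
  "is_inverse_operator T S \<longleftrightarrow> (\<forall>x y. T x = Some y \<longleftrightarrow> S y = Some x)"

definition bounded_linear_operator ::
    "('k::real_normed_field \<Rightarrow> 'x::banach \<Rightarrow> 'x) \<Rightarrow> ('x \<rightharpoonup> 'x) \<Rightarrow> bool" where
  "bounded_linear_operator smul T \<longleftrightarrow>
     linear_operator smul T \<and> dom T = UNIV \<and>
     (\<exists>C. \<forall>x. norm (the (T x)) \<le> C * norm x)"

end

theory Submission
  imports Defs
begin

text \<open>
  On \<open>Y\<close> the map \<open>B\<close> agrees with the bounded operator \<open>S = A\<^sup>-\<^sup>1\<close>, so \<open>S\<^sup>n u \<rightarrow> 0\<close> for \<open>u \<in> Y\<close>.  For
  \<open>u, v \<in> Y\<close> the vectors \<open>u + A\<^sup>n v\<close> tend to \<open>u\<close> while \<open>S\<^sup>n (u + A\<^sup>n v) = S\<^sup>n u + v\<close> tends to \<open>v\<close>.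
  Hence \<open>S\<close> is topologically transitive, and Baire's theorem yields a dense set of vectors with
  dense orbit.  The periodic points of \<open>A\<close> are periodic for \<open>S\<close>.
\<close>

text \<open>An orbit is dense once it meets every ball of radius \<open>1 / Suc m\<close> centred in
  a countable dense set. These are countably many conditions; each defines an open set by continuity
  of the iterates and a dense one by transitivity, so Baire's theorem applies.\<close>

lemma birkhoff_transitivity:
  fixes S :: "'a::complete_space \<Rightarrow> 'a"
  assumes sep: "\<exists>D :: 'a set. countable D \<and> closure D = UNIV"
    and cont: "continuous_on UNIV S"
    and trans: "\<And>U V. open U \<Longrightarrow> open V \<Longrightarrow> U \<noteq> {} \<Longrightarrow> V \<noteq> {} \<Longrightarrow> \<exists>n. \<exists>x\<in>U. (S ^^ n) x \<in> V"
  shows "closure {x. closure (range (\<lambda>n. (S ^^ n) x)) = UNIV} = UNIV"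
proof -
  obtain D :: "'a set" where D: "countable D" "closure D = UNIV"
    using sep by blast
  define G where "G = (\<lambda>(d, m). \<Union>n. (S ^^ n) -` ball d (1 / Suc m))"
  define \<G> where "\<G> = G ` (D \<times> (UNIV :: nat set))"
  have contn: "continuous_on UNIV (S ^^ n)" for n
    by (induction n) (auto simp: comp_def intro: continuous_on_compose2[OF cont])
  have op: "open T" if "T \<in> \<G>" for T
    using that by (auto simp: \<G>_def G_def intro!: open_vimage contn)
  have dense: "closure T = UNIV" if "T \<in> \<G>" for T
  proof -
    obtain d m where T: "T = G (d, m)"
      using \<open>T \<in> \<G>\<close> by (auto simp: \<G>_def)
    show ?thesis
    proof (rule ccontr)
      \<comment> \<open>Transitivity carries some point of the open complement into the ball; by
        definition of \<open>G\<close> that point already lies in \<open>T\<close>.\<close>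
      assume "closure T \<noteq> UNIV"
      then have "- closure T \<noteq> {}"
        by auto
      then obtain n x where "x \<in> - closure T" "(S ^^ n) x \<in> ball d (1 / Suc m)"
        using trans[of "- closure T" "ball d (1 / Suc m)"] by auto
      then show False
        using closure_subset[of T] unfolding T G_def by blast
    qed
  qed
  have "euclidean closure_of \<Inter>\<G> = topspace (euclidean :: 'a topology)"
  proof (rule Baire_category)
    show "completely_metrizable_space (euclidean :: 'a topology) \<or>
        locally_compact_space (euclidean :: 'a topology) \<and> regular_space (euclidean :: 'a topology)"
      by (simp add: completely_metrizable_space_euclidean)
    show "countable \<G>"
      unfolding \<G>_def using D(1) by auto
  qed (use op dense in auto)
  then have "closure (\<Inter>\<G>) = UNIV"
    by simp
  moreover have "\<Inter>\<G> \<subseteq> {x. closure (range (\<lambda>n. (S ^^ n) x)) = UNIV}"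
  proof clarify
    fix x assume x: "x \<in> \<Inter>\<G>"
    \<comment> \<open>A ball of radius below \<open>e / 2\<close> whose centre is within
      \<open>e / 2\<close> of \<open>y\<close> lies in the \<open>e\<close>-ball about
      \<open>y\<close>.\<close>
    have "\<exists>n. dist ((S ^^ n) x) y < e" if "e > 0" for y e
    proof -
      obtain m :: nat where m: "1 / Suc m < e / 2"
        using nat_approx_posE[of "e / 2"] \<open>e > 0\<close> by auto
      obtain d where d: "d \<in> D" "dist d y < e / 2"
        using D(2) \<open>e > 0\<close> closure_approachable[of y D] half_gt_zero by blast
      have "x \<in> G (d, m)"
        using x d(1) by (auto simp: \<G>_def)
      then obtain n where "dist d ((S ^^ n) x) < 1 / Suc m"
        by (auto simp: G_def)
      then have "dist ((S ^^ n) x) y < e"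
        using m d(2) dist_triangle[of "(S ^^ n) x" y d] by (simp add: dist_commute)
      then show ?thesis ..
    qed
    then show "closure (range (\<lambda>n. (S ^^ n) x)) = UNIV"
      by (auto simp: closure_approachable)
  qed
  ultimately show ?thesis
    by (metis closure_mono top.extremum_uniqueI)
qed

lemma op_pow_total: "op_pow (\<lambda>x. Some (S x)) n = (\<lambda>x. Some ((S ^^ n) x))"
  by (induction n) (auto simp: map_comp_def)

text \<open>One application of \<open>S\<close> undoes the outermost factor \<open>A\<close>;
  \<open>funpow_swap1\<close> puts that application innermost in \<open>S ^^ Suc n\<close>, where
  the induction hypothesis takes over.\<close>

lemma inverse_op_pow:
  assumes "\<And>x y. A x = Some y \<Longrightarrow> S y = x" and "op_pow A n x = Some y"
  shows "(S ^^ n) y = x"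
  using assms(2)
proof (induction n arbitrary: y)
  case (Suc n)
  then obtain z where z: "op_pow A n x = Some z" "A z = Some y"
    by (auto simp: map_comp_def split: option.splits)
  then show ?case
    using Suc.IH[OF z(1)] assms(1)[OF z(2)] by (simp add: funpow_swap1)
qed simp

lemma periodic_point_inverse:
  assumes "\<And>x y. A x = Some y \<Longrightarrow> S y = x" and "periodic_point A f"
  shows "periodic_point (\<lambda>x. Some (S x)) f"
  using assms inverse_op_pow[of A S] unfolding periodic_point_def op_pow_total by blast

text \<open>The maps \<open>R n\<close> are right inverses of \<open>S ^^ n\<close> on
  \<open>Y\<close>. They stand for the powers of \<open>A\<close>, which are only partially defined;
  the bound \<open>n \<ge> 1\<close> matches the index set of \<open>C_infinity\<close>.\<close>

lemma topologically_transitive_criterion: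
  fixes S :: "'a::real_normed_vector \<Rightarrow> 'a"
  assumes add: "\<And>x y. S (x + y) = S x + S y"
    and dense: "closure Y = UNIV"
    and S0: "\<And>y. y \<in> Y \<Longrightarrow> (\<lambda>n. (S ^^ n) y) \<longlonglongrightarrow> 0"
    and R0: "\<And>y. y \<in> Y \<Longrightarrow> (\<lambda>n. R n y) \<longlonglongrightarrow> 0"
    and SR: "\<And>n y. n \<ge> 1 \<Longrightarrow> y \<in> Y \<Longrightarrow> (S ^^ n) (R n y) = y"
    and UV: "open U" "open V" "U \<noteq> {}" "V \<noteq> {}"
  shows "\<exists>n. \<exists>x\<in>U. (S ^^ n) x \<in> V"
proof -
  have addn: "(S ^^ n) (x + y) = (S ^^ n) x + (S ^^ n) y" for n x y
    by (induction n) (simp_all add: add)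
  obtain u v where u: "u \<in> Y" "u \<in> U" and v: "v \<in> Y" "v \<in> V"
    using UV dense open_Int_closure_eq_empty[of U Y] open_Int_closure_eq_empty[of V Y] by auto
  have "(\<lambda>n. u + R n v) \<longlonglongrightarrow> u"
    using tendsto_add[OF tendsto_const R0[OF v(1)], of u] by simp
  then have "\<forall>\<^sub>F n in sequentially. u + R n v \<in> U"
    using UV(1) u(2) by (rule topological_tendstoD)
  moreover have "(\<lambda>n. (S ^^ n) u + v) \<longlonglongrightarrow> v"
    using tendsto_add[OF S0[OF u(1)] tendsto_const, of v] by simp
  then have "\<forall>\<^sub>F n in sequentially. (S ^^ n) u + v \<in> V"
    using UV(2) v(2) by (rule topological_tendstoD)
  \<comment> \<open>A single \<open>n\<close> has to serve both limits and also be at least 1, where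
    \<open>SR\<close> becomes available.\<close>
  ultimately have "\<forall>\<^sub>F n in sequentially. 1 \<le> n \<and> u + R n v \<in> U \<and> (S ^^ n) u + v \<in> V"
    using eventually_ge_at_top[of 1] by eventually_elim auto
  then obtain n where "1 \<le> n" "u + R n v \<in> U" "(S ^^ n) u + v \<in> V"
    using eventually_happens'[OF sequentially_bot] by blast
  moreover have "(S ^^ n) (u + R n v) = (S ^^ n) u + v"
    using SR[OF \<open>1 \<le> n\<close> v(1)] addn by simp
  ultimately show ?thesis
    by metis
qed

theorem corollary4p2:
  fixes smul :: "'k::real_normed_field \<Rightarrow> 'x::banach \<Rightarrow> 'x"
    and A A_inv :: "'x \<rightharpoonup> 'x"
    and Y :: "'x set" and B :: "'x \<Rightarrow> 'x"
  assumes "banach_space_over smul"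
    and "infinite_dimensional smul"
    and "\<exists>S :: 'x set. countable S \<and> closure S = UNIV"
    and "chaotic smul A"
    and "densely_defined A"
    and "\<And>n. n \<ge> 1 \<Longrightarrow> closed_operator (op_pow A n)"
    and "Y \<subseteq> C_infinity A"
    and "closure Y = UNIV"
    and "B \<in> Y \<rightarrow> Y"
    and "\<And>f. f \<in> Y \<Longrightarrow> A (B f) = Some f"
    and "\<And>f. f \<in> Y \<Longrightarrow> (\<lambda>n. the (op_pow A n f)) \<longlonglongrightarrow> 0"
    and "\<And>f. f \<in> Y \<Longrightarrow> (\<lambda>n. (B ^^ n) f) \<longlonglongrightarrow> 0"
    and "is_inverse_operator A A_inv"
    and "bounded_linear_operator smul A_inv"
  shows "chaotic smul A_inv"
proof -
  define S where "S = (\<lambda>x. the (A_inv x))"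
  have A_inv: "A_inv = (\<lambda>x. Some (S x))"
  proof
    fix x
    have "x \<in> dom A_inv"
      using assms(14) by (simp add: bounded_linear_operator_def)
    then show "A_inv x = Some (S x)"
      by (auto simp: S_def)
  qed
  have lin: "linear_operator smul A_inv"
    using assms(14) by (simp add: bounded_linear_operator_def)
  have add: "S (x + y) = S x + S y" for x y
    using lin by (simp add: linear_operator_def A_inv)
  obtain C where C: "\<And>x. norm (S x) \<le> C * norm x"
    using assms(14) by (auto simp: bounded_linear_operator_def S_def)
  have inv: "S y = x" if "A x = Some y" for x y
    using that assms(13) by (auto simp: is_inverse_operator_def A_inv)
  have cont: "continuous_on UNIV S"
  proof -
    have "S x - S y = S (x - y)" for x y
      using add[of "x - y" y] by simp
    \<comment> \<open>Nothing fixes the sign of \<open>C\<close>, while a Lipschitz constant must be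
      nonnegative.\<close>
    moreover have "norm (S x) \<le> max C 0 * norm x" for x
      by (rule order_trans[OF C mult_right_mono]) auto
    ultimately have "(max C 0)-lipschitz_on UNIV S"
      by (intro lipschitz_onI) (auto simp: dist_norm)
    then show ?thesis
      by (rule lipschitz_on_continuous_on)
  qed
  \<comment> \<open>Applying \<open>S\<close> to \<open>A (B f) = Some f\<close> gives
    \<open>S f = B f\<close> on \<open>Y\<close>; invariance of \<open>Y\<close> under
    \<open>B\<close> lets this iterate.\<close>
  have SB: "(S ^^ n) f = (B ^^ n) f \<and> (B ^^ n) f \<in> Y" if "f \<in> Y" for f n
    using that assms(9) inv[OF assms(10)] by (induction n) auto
  define H where "H = {x. closure (range (\<lambda>n. (S ^^ n) x)) = UNIV}"
  have "closure H = UNIV"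
    unfolding H_def
  proof (rule birkhoff_transitivity[OF assms(3) cont])
    fix U V :: "'x set"
    assume UV: "open U" "open V" "U \<noteq> {}" "V \<noteq> {}"
    show "\<exists>n. \<exists>x\<in>U. (S ^^ n) x \<in> V"
    proof (rule topologically_transitive_criterion[where R = "\<lambda>n f. the (op_pow A n f)",
          OF add assms(8) _ assms(11) _ UV])
      show "(\<lambda>n. (S ^^ n) f) \<longlonglongrightarrow> 0" if "f \<in> Y" for f
        using assms(12)[OF that] SB[OF that] by simp
      show "(S ^^ n) (the (op_pow A n f)) = f" if "n \<ge> 1" "f \<in> Y" for n f
      proof (rule inverse_op_pow[of A, OF inv])
        have "f \<in> dom (op_pow A n)"
          using that assms(7) unfolding C_infinity_def by blast
        then show "op_pow A n f = Some (the (op_pow A n f))"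
          by auto
      qed
    qed
  qed
  \<comment> \<open>A hypercyclic vector must be nonzero. The hypercyclic vector of \<open>A\<close>
    shows that the open set \<open>- {0}\<close> is nonempty, so the dense set \<open>H\<close>
    meets it.\<close>
  moreover have "- {0 :: 'x} \<noteq> {}"
    using assms(4) by (auto simp: chaotic_def hypercyclic_def)
  ultimately have "- {0} \<inter> H \<noteq> {}"
    using open_Int_closure_eq_empty[of "- {0 :: 'x}" H] by (metis Int_UNIV_right closed_singleton open_Compl)
  then obtain f where "f \<noteq> 0" "closure (range (\<lambda>n. (S ^^ n) f)) = UNIV"
    unfolding H_def by blast
  then have "hypercyclic smul A_inv"
    using lin unfolding hypercyclic_def A_inv op_pow_total by auto
  moreover have "closure {f. periodic_point A_inv f} = UNIV"
  proof -
    have "{f. periodic_point A f} \<subseteq> {f. periodic_point A_inv f}"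
      unfolding A_inv using periodic_point_inverse[of A S, OF inv] by blast
    from closure_mono[OF this] show ?thesis
      using assms(4) by (auto simp: chaotic_def)
  qed
  ultimately show ?thesis
    by (simp add: chaotic_def)
qed

end
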